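(* Let $p$ be a prime, let $d$ be a positive integer with $(d,p)=1$, and let $c\ge2$ be an integer with $(c,dp)=1$. Let $X=\varprojlim_n \mathbb{Z}/dp^n\mathbb{Z}\cong\mathbb{Z}/d\mathbb{Z}\times\mathbb{Z}_p$, and let $E_{1,c}$ be the regularized Bernoulli distribution on $X$. Then for every integer $n\ge0$ and every $a\in\{0,1,\dots,dp^n-1\}$, $$E_{1,c}(a+dp^nX)=\frac{c-1}{2}-\{-a(dp^n)^{-1}\}_c,$$ where $(dp^n)^{-1}$ is the inverse of $dp^n$ modulo $c$.
   Context: For a positive integer $m$, $\{x\}_m$ denotes the unique representative of $x$ modulo $m$ in $\{0,1,\dots,m-1\}$. The (first) Bernoulli distribution $E_1$ on $X$ is defined by $E_1(a+dp^nX)=B_1\!\left(\frac{\{a\}_{dp^n}}{dp^n}\right)$ with $B_1(x)=x-\frac12$. Its regularization is defined by $$E_{1,c}(a+dp^nX)=E_1(a+dp^nX)-c\,E_1\!\left(\left\{\tfrac{a}{c}\right\}_{dp^n}+dp^nX\right),$$ where $\left\{\frac ac\right\}_{dp^n}$ is the representative in $\{0,\dots,dp^n-1\}$ of $c^{-1}a$ modulo $dp^n$. The paper denotes the right-hand side of the claim by $\epsilon_{a,c,dp^n}$. *)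

theory Defs
  imports "HOL-Number_Theory.Number_Theory" "HOL-Algebra.Ideal"
begin

text \<open>
  The projective limit of the rings \<open>\<int>/dp\<^sup>n\<int>\<close>. An element is the sequence of its components,
  each written as its representative in \<open>{0..<dp\<^sup>n}\<close>; the operations are componentwise.
\<close>

definition proj_lim :: "int \<Rightarrow> int \<Rightarrow> (nat \<Rightarrow> int) ring" where
  "proj_lim d p =
    \<lparr>carrier = {x. \<forall>n. x n \<in> {0..<d * p ^ n} \<and> x (Suc n) mod (d * p ^ n) = x n},
     monoid.mult = (\<lambda>x y n. (x n * y n) mod (d * p ^ n)),
     one = (\<lambda>n. 1 mod (d * p ^ n)),
     zero = (\<lambda>n. 0),
     add = (\<lambda>x y n. (x n + y n) mod (d * p ^ n))\<rparr>"

definition embed_int :: "int \<Rightarrow> int \<Rightarrow> int \<Rightarrow> nat \<Rightarrow> int" where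
  "embed_int d p a = (\<lambda>n. a mod (d * p ^ n))"

text \<open>The coset \<open>a + dp\<^sup>nX\<close> of the principal ideal \<open>dp\<^sup>nX\<close> of \<open>X = proj_lim d p\<close>.\<close>

definition ball_coset :: "int \<Rightarrow> int \<Rightarrow> nat \<Rightarrow> int \<Rightarrow> (nat \<Rightarrow> int) set" where
  "ball_coset d p n a =
     (PIdl\<^bsub>proj_lim d p\<^esub> (embed_int d p (d * p ^ n))) +>\<^bsub>proj_lim d p\<^esub> embed_int d p a"

definition cosets_within :: "int \<Rightarrow> int \<Rightarrow> nat \<Rightarrow> (nat \<Rightarrow> int) set \<Rightarrow> int set" where
  "cosets_within d p n U = {a \<in> {0..<d * p ^ n}. ball_coset d p n a \<subseteq> U}"

text \<open>
  The compact open subsets of \<open>X\<close> are the sets that are, for some \<open>n\<close>, a (finite) union of cosets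
  of \<open>dp\<^sup>nX\<close>. A distribution on \<open>X\<close> is a finitely additive function on them, so it is determined
  by its values on the cosets \<open>a + dp\<^sup>nX\<close>. The function below takes values \<open>\<phi> n a\<close>, prescribed
  for these cosets (with \<open>0 \<le> a < dp\<^sup>n\<close>), to the distribution that they determine: the value at
  \<open>U\<close> is the sum over the cosets of \<open>dp\<^sup>nX\<close> contained in \<open>U\<close>, for the least \<open>n\<close> such that \<open>U\<close> is
  their union. If \<open>\<phi>\<close> is compatible, that is, \<open>\<phi> n a = (\<Sum>b<p. \<phi> (n + 1) (a + b d p\<^sup>n))\<close>, then any
  other such \<open>n\<close> gives the same sum. On sets that are not compact open the value is meaningless.
\<close>

definition distribution_of ::
  "int \<Rightarrow> int \<Rightarrow> (nat \<Rightarrow> int \<Rightarrow> rat) \<Rightarrow> (nat \<Rightarrow> int) set \<Rightarrow> rat" where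
  "distribution_of d p \<phi> U =
     (let n = (LEAST n. U = (\<Union>a \<in> cosets_within d p n U. ball_coset d p n a))
      in \<Sum>a \<in> cosets_within d p n U. \<phi> n a)"

definition B1 :: "rat \<Rightarrow> rat" where
  "B1 x = x - 1 / 2"

definition E1 :: "int \<Rightarrow> int \<Rightarrow> (nat \<Rightarrow> int) set \<Rightarrow> rat" where
  "E1 d p =
     distribution_of d p (\<lambda>n a. B1 (of_int (a mod (d * p ^ n)) / of_int (d * p ^ n)))"

text \<open>
  In the second term, \<open>modular_inverse m c * a mod m\<close> with \<open>m = dp\<^sup>n\<close> is the representative of
  \<open>c\<^sup>-\<^sup>1 a\<close> modulo \<open>m\<close>; for \<open>m = 1\<close> it is \<open>0\<close>.
\<close>

definition E1_reg :: "int \<Rightarrow> int \<Rightarrow> int \<Rightarrow> (nat \<Rightarrow> int) set \<Rightarrow> rat" where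
  "E1_reg d p c =
     distribution_of d p (\<lambda>n a.
       E1 d p (ball_coset d p n a)
       - of_int c * E1 d p (ball_coset d p n ((modular_inverse (d * p ^ n) c * a) mod (d * p ^ n))))"

end

theory Submission
  imports Defs
begin

text \<open>
  The coset \<open>a + dp\<^sup>nX\<close> consists of the \<open>x\<close> with \<open>n\<close>-th component \<open>a\<close>, and contains no coset of
  lower level, so a distribution takes exactly its prescribed value there.
  With \<open>m = dp\<^sup>n\<close> and \<open>b\<close> the representative of \<open>c\<^sup>-\<^sup>1 a\<close> modulo \<open>m\<close>, the value is
  \<open>(c - 1) / 2 - q\<close> where \<open>q m = c b - a\<close>. The bounds on \<open>a\<close> and \<open>b\<close> give \<open>0 \<le> q < c\<close>, and
  \<open>q m\<close> is congruent to \<open>- a\<close> modulo \<open>c\<close>.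
\<close>

lemma proj_lim_mod:
  assumes "x \<in> carrier (proj_lim d p)"
  shows "x (n + k) mod (d * p ^ n) = x n"
proof (induction k)
  case 0
  have "x n \<in> {0..<d * p ^ n}"
    using assms by (simp add: proj_lim_def)
  then show ?case by simp
next
  case (Suc k)
  have "x (Suc (n + k)) mod (d * p ^ (n + k)) = x (n + k)"
    using assms by (simp add: proj_lim_def)
  moreover have "x (Suc (n + k)) mod (d * p ^ (n + k)) mod (d * p ^ n) = x (Suc (n + k)) mod (d * p ^ n)"
    by (rule mod_mod_cancel) (simp add: power_add)
  ultimately show ?case using Suc by simp
qed

lemma embed_int_in_proj_lim:
  assumes "d > 0" "p > 0"
  shows "embed_int d p a \<in> carrier (proj_lim d p)"
  using assms by (auto simp: embed_int_def proj_lim_def mod_mod_cancel)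

text \<open>Component \<open>k\<close> of an element of the coset is
  \<open>y k * (d * p ^ n) + a\<close> modulo \<open>d * p ^ k\<close>, and the multiple drops out
  at \<open>k = n\<close>.\<close>

lemma ball_coset_subset:
  assumes "d > 0" "p > 0" "x \<in> ball_coset d p n a"
  shows "x \<in> carrier (proj_lim d p)" "x n = a mod (d * p ^ n)"
proof -
  obtain y where y: "y \<in> carrier (proj_lim d p)"
    and x: "x = (\<lambda>k. ((y k * (d * p ^ n mod (d * p ^ k))) mod (d * p ^ k) + a mod (d * p ^ k)) mod (d * p ^ k))"
    using assms(3)
    by (auto simp: ball_coset_def a_r_coset_def r_coset_def cgenideal_def embed_int_def proj_lim_def)
  have x': "x = (\<lambda>k. (y k * (d * p ^ n) + a) mod (d * p ^ k))"
    unfolding x by (simp only: mod_mult_right_eq mod_add_eq)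
  show "x n = a mod (d * p ^ n)"
    unfolding x' by simp
  have "x (Suc k) mod (d * p ^ k) = x k" for k
  proof -
    have "x (Suc k) mod (d * p ^ k) = (y (Suc k) * (d * p ^ n) + a) mod (d * p ^ k)"
      unfolding x' by (rule mod_mod_cancel) simp
    also have "\<dots> = (y (Suc k) mod (d * p ^ k) * (d * p ^ n) + a) mod (d * p ^ k)"
      by (metis mod_add_left_eq mod_mult_left_eq)
    also have "y (Suc k) mod (d * p ^ k) = y k"
      using y by (simp add: proj_lim_def)
    finally show ?thesis unfolding x' .
  qed
  moreover have "x k \<in> {0..<d * p ^ k}" for k
    using assms(1,2) unfolding x' by simp
  ultimately show "x \<in> carrier (proj_lim d p)"
    by (simp add: proj_lim_def)
qed

text \<open>
  Division by \<open>p\<^sup>n\<close> is a shift of components; \<open>d\<close> is invertible only in the \<open>p\<close>-part of \<open>X\<close>, so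
  the quotient is chosen to vanish in \<open>\<int>/d\<close>: this is the factor \<open>d * e k\<close> below.
\<close>

lemma in_ball_cosetI:
  assumes "d > 0" "p > 0" "coprime d p"
    and x: "x \<in> carrier (proj_lim d p)" and xn: "x n = a mod (d * p ^ n)"
  shows "x \<in> ball_coset d p n a"
proof -
  define m where "m = d * p ^ n"
  have m: "m > 0" using assms by (simp add: m_def)
  have "\<exists>e. [d * e = 1] (mod p ^ k)" for k
    using assms(3) by (intro cong_solve_coprime_int) simp
  then obtain e where e: "\<And>k. [d * e k = 1] (mod p ^ k)" by metis
  \<comment> \<open>The quotient of \<open>x - a\<close> by \<open>m\<close>: since
    \<open>x (n + k)\<close> is determined modulo \<open>m * p ^ k\<close>, reading component
    \<open>n + k\<close> determines \<open>w k\<close> modulo \<open>p ^ k\<close>.\<close>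
  define w where "w k = (x (n + k) - a) div m" for k
  have "m dvd x (n + k) - a" for k
    using proj_lim_mod[OF x, of n k] xn by (simp add: m_def mod_eq_dvd_iff)
  then have w: "m * w k = x (n + k) - a" for k by (simp add: w_def)
  define y where "y k = (d * e k * w k) mod (d * p ^ k)" for k
  have step: "[d * e (Suc k) * w (Suc k) = d * e k * w k] (mod d * p ^ k)" for k
  proof -
    have "x (Suc (n + k)) mod (d * p ^ (n + k)) = x (n + k)"
      "x (n + k) \<in> {0..<d * p ^ (n + k)}"
      using x by (auto simp: proj_lim_def)
    then have "x (Suc (n + k)) mod (d * p ^ (n + k)) = x (n + k) mod (d * p ^ (n + k))" by simp
    then have "m * p ^ k dvd x (Suc (n + k)) - x (n + k)"
      unfolding m_def by (simp add: mod_eq_dvd_iff power_add mult.assoc)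
    also have "x (Suc (n + k)) - x (n + k) = m * (w (Suc k) - w k)"
      using w[of "Suc k"] w[of k] by (simp add: algebra_simps)
    finally have ww: "[w (Suc k) = w k] (mod p ^ k)"
      using m by (simp add: cong_iff_dvd_diff)
    have "[d * e (Suc k) = 1] (mod p ^ k)"
      using e[of "Suc k"] by (rule cong_dvd_modulus) simp
    then have "[d * e (Suc k) = d * e k] (mod p ^ k)"
      using e[of k] by (meson cong_sym cong_trans)
    moreover have "coprime d (p ^ k)" using assms(3) by simp
    ultimately have "[e (Suc k) = e k] (mod p ^ k)"
      by (simp add: cong_mult_lcancel)
    then have "[e (Suc k) * w (Suc k) = e k * w k] (mod p ^ k)"
      using ww by (rule cong_mult)
    \<comment> \<open>The common factor \<open>d\<close> raises the congruence from modulus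
      \<open>p ^ k\<close> to \<open>d * p ^ k\<close>.\<close>
    then show ?thesis
      unfolding cong_iff_dvd_diff mult.assoc right_diff_distrib[symmetric] by (rule mult_dvd_mono[OF dvd_refl])
  qed
  have "y (Suc k) mod (d * p ^ k) = y k" for k
  proof -
    have "y (Suc k) mod (d * p ^ k) = (d * e (Suc k) * w (Suc k)) mod (d * p ^ k)"
      unfolding y_def by (rule mod_mod_cancel) simp
    also have "\<dots> = y k"
      using step[of k] unfolding y_def cong_def .
    finally show ?thesis .
  qed
  then have y: "y \<in> carrier (proj_lim d p)"
    using assms(1,2) by (simp add: proj_lim_def y_def)
  have "x k = ((y k * (m mod (d * p ^ k))) mod (d * p ^ k) + a mod (d * p ^ k)) mod (d * p ^ k)" for k
  proof -
    \<comment> \<open>The factor \<open>d\<close> that is missing from this divisor is supplied by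
      \<open>m\<close>, so after multiplication by \<open>m\<close> the numbers \<open>w k\<close>
      and \<open>d * e k * w k\<close> agree modulo \<open>d * p ^ k\<close>.\<close>
    have "p ^ k dvd d * e k - 1" using e[of k] by (simp add: cong_iff_dvd_diff)
    then have "d * p ^ k dvd m * (d * e k - 1)"
      unfolding m_def by (simp add: mult.assoc dvd_mult)
    then have "d * p ^ k dvd m * (d * e k - 1) * w k" by (rule dvd_mult2)
    also have "m * (d * e k - 1) * w k = d * e k * w k * m + a - x (n + k)"
      using w[of k] by (simp add: algebra_simps)
    finally have "(d * e k * w k * m + a) mod (d * p ^ k) = x (n + k) mod (d * p ^ k)"
      by (simp add: mod_eq_dvd_iff)
    also have "\<dots> = x k"
      using proj_lim_mod[OF x, of k n] by (simp add: add.commute)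
    finally show ?thesis unfolding y_def by (simp only: mod_mult_eq mod_add_eq)
  qed
  then have "x = (y \<otimes>\<^bsub>proj_lim d p\<^esub> embed_int d p m) \<oplus>\<^bsub>proj_lim d p\<^esub> embed_int d p a"
    unfolding proj_lim_def embed_int_def by (simp add: fun_eq_iff)
  then show ?thesis
    using y by (auto simp: ball_coset_def a_r_coset_def r_coset_def cgenideal_def m_def)
qed

lemma ball_coset_eq:
  assumes "d > 0" "p > 0" "coprime d p"
  shows "ball_coset d p n a = {x \<in> carrier (proj_lim d p). x n = a mod (d * p ^ n)}"
  using assms by (auto intro: in_ball_cosetI dest: ball_coset_subset)

text \<open>Integers serve as test points: inclusions between cosets are refuted by congruences
  alone.\<close>

lemma embed_int_in_ball_coset:
  assumes "d > 0" "p > 0" "coprime d p"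
  shows "embed_int d p b \<in> ball_coset d p n a \<longleftrightarrow> b mod (d * p ^ n) = a mod (d * p ^ n)"
  using assms by (simp add: ball_coset_eq embed_int_in_proj_lim) (simp add: embed_int_def)

lemma cosets_within_ball_coset:
  assumes "d > 0" "p > 0" "coprime d p" "a \<in> {0..<d * p ^ n}"
  shows "cosets_within d p n (ball_coset d p n a) = {a}"
proof -
  have "b = a" if "b \<in> {0..<d * p ^ n}" "ball_coset d p n b \<subseteq> ball_coset d p n a" for b
    using that assms embed_int_in_ball_coset[OF assms(1-3), of b n b]
      embed_int_in_ball_coset[OF assms(1-3), of b n a] by auto
  then show ?thesis using assms(4) by (auto simp: cosets_within_def)
qed

text \<open>A coset of level \<open>k < n\<close> contains both \<open>b\<close> and
  \<open>b + d * p ^ k\<close>, which differ modulo \<open>d * p ^ n\<close>.\<close>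

lemma cosets_within_ball_coset_smaller:
  assumes "d > 0" "p > 1" "coprime d p" "k < n"
  shows "cosets_within d p k (ball_coset d p n a) = {}"
proof (rule ccontr)
  assume "cosets_within d p k (ball_coset d p n a) \<noteq> {}"
  then obtain b where b: "ball_coset d p k b \<subseteq> ball_coset d p n a"
    by (auto simp: cosets_within_def)
  have p: "p > 0" using assms by simp
  note in_ball = embed_int_in_ball_coset[OF assms(1) p assms(3)]
  have "embed_int d p b \<in> ball_coset d p n a" "embed_int d p (b + d * p ^ k) \<in> ball_coset d p n a"
    by (rule subsetD[OF b], simp add: in_ball)+
  then have "(b + d * p ^ k) mod (d * p ^ n) = b mod (d * p ^ n)"
    by (simp add: in_ball)
  then have "d * p ^ n dvd d * p ^ k" by (simp add: mod_eq_dvd_iff)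
  then have "p ^ n \<le> p ^ k" using assms(1) p by (intro zdvd_imp_le) auto
  then show False using assms by simp
qed

lemma distribution_of_ball_coset:
  assumes "d > 0" "p > 1" "coprime d p" "a \<in> {0..<d * p ^ n}"
  shows "distribution_of d p \<phi> (ball_coset d p n a) = \<phi> n a"
proof -
  let ?U = "ball_coset d p n a"
  have p: "p > 0" using assms by simp
  note within = cosets_within_ball_coset[OF assms(1) p assms(3,4)]
  have "(LEAST k. ?U = (\<Union>b \<in> cosets_within d p k ?U. ball_coset d p k b)) = n"
  proof (rule Least_equality)
    show "?U = (\<Union>b \<in> cosets_within d p n ?U. ball_coset d p n b)" by (simp add: within)
  next
    fix k assume U: "?U = (\<Union>b \<in> cosets_within d p k ?U. ball_coset d p k b)"
    \<comment> \<open>A nonempty set is not an empty union, so some coset of level \<open>k\<close>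
      lies in \<open>?U\<close>, which excludes \<open>k < n\<close>.\<close>
    have "embed_int d p a \<in> ?U"
      by (simp add: embed_int_in_ball_coset[OF assms(1) p assms(3)])
    with U have "cosets_within d p k ?U \<noteq> {}" by auto
    then show "n \<le> k"
      using cosets_within_ball_coset_smaller[OF assms(1-3)] by (meson not_le)
  qed
  then show ?thesis by (simp add: distribution_of_def within)
qed

theorem theorem3p1:
  fixes p d c a :: int and n :: nat
  assumes "prime p"
    and "d > 0"
    and "coprime d p"
    and "c \<ge> 2"
    and "coprime c (d * p)"
    and "a \<in> {0..d * p ^ n - 1}"
  shows "E1_reg d p c (ball_coset d p n a) =
    of_int (c - 1) / 2 - of_int ((- a * modular_inverse c (d * p ^ n)) mod c)"
proof -
  define m where "m = d * p ^ n"
  define b where "b = (modular_inverse m c * a) mod m"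
  define q where "q = (c * b - a) div m"
  have p: "p > 1" using assms(1) by (rule prime_gt_1_int)
  have m: "m > 0" using assms(2) p by (simp add: m_def)
  have a: "0 \<le> a" "a < m" using assms(6) by (auto simp: m_def)
  have b: "0 \<le> b" "b < m" using m by (simp_all add: b_def)
  have cop: "coprime c m" using assms(5) by (simp add: m_def)
  have "[c * b = c * (modular_inverse m c * a)] (mod m)"
    unfolding b_def by (simp add: cong_def mod_simps)
  also have "c * (modular_inverse m c * a) = (modular_inverse m c * c) * a" by simp
  also have "[\<dots> = 1 * a] (mod m)"
    using cop by (intro cong_mult cong_refl cong_modular_inverse2)
  \<comment> \<open>The congruence \<open>c * b = a\<close> modulo \<open>m\<close> makes the
    division defining \<open>q\<close> exact.\<close>
  finally have q: "q * m = c * b - a"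
    by (simp add: q_def cong_iff_dvd_diff)
  \<comment> \<open>Here \<open>c * b \<ge> 0\<close> and \<open>a < m\<close>; being an integer
    greater than \<open>-1\<close>, \<open>q\<close> is nonnegative.\<close>
  have "- m < q * m" using q a b assms(4) by (smt (verit) mult_nonneg_nonneg)
  then have "0 < (q + 1) * m" by (simp add: algebra_simps)
  then have q0: "0 \<le> q" using m by (simp add: zero_less_mult_iff)
  have "q * m < c * m" using q a b assms(4) by (smt (verit) mult_strict_left_mono)
  then have qc: "q < c" using m by simp
  \<comment> \<open>Multiplying \<open>q * m = c * b - a\<close> by the inverse of \<open>m\<close>
    modulo \<open>c\<close> isolates \<open>q\<close> and kills the term with
    \<open>b\<close>.\<close>
  have "[q = q * (modular_inverse c m * m)] (mod c)"
    using cong_mult[OF cong_refl cong_modular_inverse2, of m c q] cop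
    by (simp add: cong_sym_eq coprime_commute)
  also have "q * (modular_inverse c m * m) = modular_inverse c m * (c * b - a)"
    using q by (simp add: mult.left_commute)
  also have "[\<dots> = - a * modular_inverse c m] (mod c)"
    by (simp add: cong_iff_dvd_diff algebra_simps)
  finally have q_eq: "q = (- a * modular_inverse c m) mod c"
    using q0 qc by (simp add: cong_def)
  have E1: "E1 d p (ball_coset d p n r) = of_int r / of_int m - 1 / 2" if "0 \<le> r" "r < m" for r
    using distribution_of_ball_coset[OF assms(2) p assms(3), of r n] that
    by (simp add: E1_def B1_def m_def)
  \<comment> \<open>The evaluation on cosets is used twice: here for the outer distribution, and in
    \<open>E1\<close> for the values that it prescribes.\<close>
  have "E1_reg d p c (ball_coset d p n a) =
      E1 d p (ball_coset d p n a) - of_int c * E1 d p (ball_coset d p n b)"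
    using distribution_of_ball_coset[OF assms(2) p assms(3), of a n] a
    by (simp add: E1_reg_def b_def m_def)
  \<comment> \<open>The constants \<open>-1/2\<close> and \<open>c/2\<close> combine to
    \<open>(c - 1)/2\<close>, and the fractions to \<open>-q\<close>.\<close>
  also have "\<dots> = (of_int c - 1) / 2 - of_int (c * b - a) / of_int m"
    using m by (simp add: E1 a b field_simps)
  also have "\<dots> = (of_int c - 1) / 2 - of_int q"
    using m by (simp flip: q)
  finally show ?thesis by (simp add: q_eq m_def)
qed

end
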